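(* Let $G \in \mathscr{L}$ be a strongly topological gyrogroup with a symmetric base $\mathscr{B}$ at the identity element $0$. Then for each open neighborhood $U$ of $0$ in $G$, there exists a continuous homomorphism $\pi$ of $G$ onto a metrizable strongly topological gyrogroup $H$ such that $\pi^{-1}(V) \subseteq U$ for some open neighborhood $V$ of the identity element $0_H$ of $H$.
   Context: All topological spaces are assumed to be Hausdorff. $\mathscr{L}$ denotes a class of Lindelöf spaces that is closed under finite products (so if $X,Y\in\mathscr{L}$ then $X\times Y\in\mathscr{L}$; in particular, all finite powers of a member of $\mathscr{L}$ are Lindelöf). A gyrogroup is a set $G$ with a binary operation $\oplus$ such that: (G1) there is a unique identity element $0\in G$ with $0\oplus a=a=a\oplus 0$ for all $a\in G$; (G2) for each $x\in G$ there is a unique inverse $\ominus x\in G$ with $\ominus x\oplus x=0=x\oplus(\ominus x)$; (G3) for all $x,y\in G$ there is an automorphism $\mathrm{gyr}[x,y]\in \mathrm{Aut}(G,\oplus)$ with $x\oplus(y\oplus z)=(x\oplus y)\oplus \mathrm{gyr}[x,y](z)$ for all $z\in G$; (G4) $\mathrm{gyr}[x\oplus y,y]=\mathrm{gyr}[x,y]$ for all $x,y\in G$. A homomorphism of gyrogroups is a map preserving $\oplus$. A topological gyrogroup is a gyrogroup $G$ with a topology such that $\oplus:G\times G\to G$ is (jointly) continuous and $x\mapsto\ominus x$ is continuous. A topological gyrogroup $G$ is a strongly topological gyrogroup if there is a neighborhood base $\mathscr{B}$ at $0$ such that $\mathrm{gyr}[x,y](B)=B$ for all $B\in\mathscr{B}$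 and all $x,y\in G$. One may assume each $B\in\mathscr{B}$ is symmetric, i.e. $\ominus B=B$. "A strongly topological gyrogroup with a symmetric base $\mathscr{B}$ at $0$" means that such a neighborhood base $\mathscr{B}$, consisting of symmetric open sets, is fixed. *)

theory Defs
  imports "HOL-Analysis.Analysis" "HOL-Algebra.Group"
begin

text \<open>The gyrogroup operation is the \<open>mult\<close> field of the library's \<open>monoid\<close> record and its
  identity element \<open>0\<close> is the \<open>one\<close> field, so that the library notions \<open>hom\<close>, \<open>iso\<close> and \<open>m_inv\<close>
  (which do not depend on associativity) are available.\<close>

record 'a gyro = "'a monoid" +
  gyr :: "'a \<Rightarrow> 'a \<Rightarrow> 'a \<Rightarrow> 'a"

text \<open>The values of \<open>gyr G\<close> are functions on the whole type and only matter on the carrier; hence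
  automorphisms are elements of \<open>iso G G\<close>, and \<open>G4\<close> is equality on the carrier.\<close>

locale gyrogroup =
  fixes G :: "('a, 'm) gyro_scheme" (structure)
  assumes closed: "\<lbrakk>x \<in> carrier G; y \<in> carrier G\<rbrakk> \<Longrightarrow> x \<otimes> y \<in> carrier G"
    and G1: "e \<in> carrier G \<and> (\<forall>a\<in>carrier G. e \<otimes> a = a \<and> a \<otimes> e = a) \<longleftrightarrow> e = \<one>"
    and G2: "x \<in> carrier G \<Longrightarrow> \<exists>!y. y \<in> carrier G \<and> y \<otimes> x = \<one> \<and> x \<otimes> y = \<one>"
    and G3_aut: "\<lbrakk>x \<in> carrier G; y \<in> carrier G\<rbrakk> \<Longrightarrow> gyr G x y \<in> iso G G"
    and G3: "\<lbrakk>x \<in> carrier G; y \<in> carrier G; z \<in> carrier G\<rbrakk>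
      \<Longrightarrow> x \<otimes> (y \<otimes> z) = (x \<otimes> y) \<otimes> gyr G x y z"
    and G4: "\<lbrakk>x \<in> carrier G; y \<in> carrier G; z \<in> carrier G\<rbrakk>
      \<Longrightarrow> gyr G (x \<otimes> y) y z = gyr G x y z"

locale topological_gyrogroup = gyrogroup G
  for G :: "('a, 'm) gyro_scheme" (structure) +
  fixes T :: "'a topology"
  assumes topspace: "topspace T = carrier G"
    and Hausdorff: "Hausdorff_space T"
    and continuous_mult: "continuous_map (prod_topology T T) T (\<lambda>(x, y). x \<otimes> y)"
    and continuous_inverse: "continuous_map T T (m_inv G)"

text \<open>Members of a neighbourhood base need not be open. The library's \<open>neighbourhood_base_at\<close>
  does not require every set in the family to be a neighbourhood.\<close>

definition is_nbhd_base :: "'a topology \<Rightarrow> 'a \<Rightarrow> 'a set set \<Rightarrow> bool" where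
  "is_nbhd_base T x \<B> \<longleftrightarrow>
     (\<forall>B\<in>\<B>. B \<subseteq> topspace T \<and> (\<exists>W. openin T W \<and> x \<in> W \<and> W \<subseteq> B)) \<and>
     (\<forall>W. openin T W \<and> x \<in> W \<longrightarrow> (\<exists>B\<in>\<B>. B \<subseteq> W))"

definition gyr_invariant_base :: "('a, 'm) gyro_scheme \<Rightarrow> 'a topology \<Rightarrow> 'a set set \<Rightarrow> bool" where
  "gyr_invariant_base G T \<B> \<longleftrightarrow>
     is_nbhd_base T \<one>\<^bsub>G\<^esub> \<B> \<and>
     (\<forall>B\<in>\<B>. \<forall>x\<in>carrier G. \<forall>y\<in>carrier G. gyr G x y ` B = B)"

locale strongly_topological_gyrogroup = topological_gyrogroup +
  assumes strong: "\<exists>\<B>. gyr_invariant_base G T \<B>"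

definition symmetric_base :: "('a, 'm) gyro_scheme \<Rightarrow> 'a topology \<Rightarrow> 'a set set \<Rightarrow> bool" where
  "symmetric_base G T \<B> \<longleftrightarrow>
     gyr_invariant_base G T \<B> \<and> (\<forall>B\<in>\<B>. openin T B \<and> m_inv G ` B = B)"

text \<open>A class of spaces is given by a set \<open>L\<close> of topologies on a type \<open>'u\<close>, with membership read
  up to homeomorphism, so that a space on any type can belong to it; in particular products, which
  live on another type. Leaving \<open>'u\<close> arbitrary loses no generality: the finite powers of a given
  space can all be realised on a single type.\<close>

definition in_class :: "'b topology \<Rightarrow> 'u topology set \<Rightarrow> bool" where
  "in_class X L \<longleftrightarrow> (\<exists>Y\<in>L. X homeomorphic_space Y)"

definition productive_Lindelof_class :: "'u topology set \<Rightarrow> bool" where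
  "productive_Lindelof_class L \<longleftrightarrow>
     (\<forall>X\<in>L. Hausdorff_space X \<and> Lindelof_space X) \<and>
     (\<forall>X\<in>L. \<forall>Y\<in>L. in_class (prod_topology X Y) L)"

end

theory Submission
  imports Defs
begin

text \<open>
  Let \<open>g : G \<times> G \<rightarrow> \<real>\<close> be continuous. Since \<open>G \<times> G\<close> is Lindelof and \<open>G\<close> is Tychonoff, for
  each \<open>n\<close> countably many boxes \<open>{u < 1} \<times> {v < 1}\<close> on which \<open>g\<close> oscillates by less than \<open>1/(n+1)\<close>
  cover \<open>G \<times> G\<close>; hence \<open>g\<close> is already continuous for the weak topology of a countable set of
  continuous real functions on \<open>G\<close>. Applying this to \<open>f(x \<oplus> y)\<close> and iterating countably often yields
  a countable set \<open>F\<close> of functions, containing one that separates \<open>0\<close> from the complement of \<open>U\<close>,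
  whose weak topology makes \<open>\<oplus>\<close> and \<open>\<ominus>\<close> continuous. In the same iteration one adds, for every basic
  weak neighbourhood of \<open>0\<close>, a function \<open>g\<close> with \<open>g 0 < 1\<close> such that \<open>{g < 1}\<close> lies in a
  \<open>gyr\<close>-invariant \<open>B\<close> inside that neighbourhood. The quotient of \<open>G\<close> identifying points on which all
  of \<open>F\<close> agrees is then \<open>H\<close>: it embeds in \<open>\<real>\<^sup>F\<close>, and it is a gyrogroup because \<open>gyr\<close> is a term in
  \<open>\<oplus>\<close> and \<open>\<ominus>\<close>.
\<close>

section \<open>Algebra of gyrogroups\<close>

context gyrogroup
begin

lemma one_closed [simp]: "\<one> \<in> carrier G"
  and l_one [simp]: "a \<in> carrier G \<Longrightarrow> \<one> \<otimes> a = a"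
  and r_one [simp]: "a \<in> carrier G \<Longrightarrow> a \<otimes> \<one> = a"
  using G1 [of "\<one>"] by auto

lemma inv_closed [simp]: "x \<in> carrier G \<Longrightarrow> inv x \<in> carrier G"
  and l_inv [simp]: "x \<in> carrier G \<Longrightarrow> inv x \<otimes> x = \<one>"
  and r_inv [simp]: "x \<in> carrier G \<Longrightarrow> x \<otimes> inv x = \<one>"
proof -
  assume x: "x \<in> carrier G"
  \<comment> \<open>This is \<open>G2\<close> with its conjuncts in the order of the definite
    description in \<open>m_inv_def\<close>.\<close>
  have "\<exists>!y. y \<in> carrier G \<and> x \<otimes> y = \<one> \<and> y \<otimes> x = \<one>"
    using G2 [OF x] by (metis (no_types, lifting))
  from theI' [OF this]
  show "inv x \<in> carrier G" "inv x \<otimes> x = \<one>" "x \<otimes> inv x = \<one>"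
    unfolding m_inv_def by auto
qed

lemma inv_equality:
  assumes "x \<in> carrier G" "y \<in> carrier G" "y \<otimes> x = \<one>" "x \<otimes> y = \<one>"
  shows "inv x = y"
  using G2 [OF assms(1)] assms by (metis inv_closed l_inv r_inv)

lemma gyr_bij: "\<lbrakk>x \<in> carrier G; y \<in> carrier G\<rbrakk> \<Longrightarrow> bij_betw (gyr G x y) (carrier G) (carrier G)"
  using G3_aut by (auto simp: iso_def)

lemma gyr_closed: "\<lbrakk>x \<in> carrier G; y \<in> carrier G; z \<in> carrier G\<rbrakk> \<Longrightarrow> gyr G x y z \<in> carrier G"
  using gyr_bij bij_betwE by blast

lemma gyr_mult:
  "\<lbrakk>x \<in> carrier G; y \<in> carrier G; z \<in> carrier G; w \<in> carrier G\<rbrakk>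
    \<Longrightarrow> gyr G x y (z \<otimes> w) = gyr G x y z \<otimes> gyr G x y w"
  using G3_aut by (auto simp: iso_def hom_def)

text \<open>By \<open>G3\<close>, multiplying by \<open>inv a\<close> turns
  \<open>a \<otimes> b\<close> into \<open>gyr G (inv a) a b\<close>, because
  \<open>inv a \<otimes> a\<close> is the identity; gyrations are injective.\<close>

lemma l_cancel:
  assumes "a \<in> carrier G" "b \<in> carrier G" "c \<in> carrier G" "a \<otimes> b = a \<otimes> c"
  shows "b = c"
proof -
  have "gyr G (inv a) a b = gyr G (inv a) a c"
    using G3 [of "inv a" a b] G3 [of "inv a" a c] assms by (simp add: gyr_closed)
  then show ?thesis
    using gyr_bij [of "inv a" a] assms by (auto simp: bij_betw_def inj_on_def)
qed

text \<open>\<open>G4\<close> applied to \<open>inv a\<close> and \<open>a\<close> reduces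
  \<open>gyr G (inv a) a\<close> to \<open>gyr G \<one> a\<close>, and \<open>l_cancel\<close> shows
  that the latter is the identity map.\<close>

lemma inv_mult_cancel [simp]:
  assumes a: "a \<in> carrier G" and b: "b \<in> carrier G"
  shows "inv a \<otimes> (a \<otimes> b) = b"
proof -
  have "gyr G (inv a) a b = gyr G \<one> a b"
    using G4 [of "inv a" a b] assms by simp
  also have "\<dots> = b"
    using G3 [of "\<one>" a b] l_cancel [of a "gyr G \<one> a b" b] assms by (simp add: gyr_closed closed)
  finally show ?thesis
    using G3 [of "inv a" a b] assms by (simp add: gyr_closed)
qed

lemma inv_inv [simp]: "a \<in> carrier G \<Longrightarrow> inv (inv a) = a"
  by (rule inv_equality) auto

lemma mult_inv_cancel [simp]:
  "\<lbrakk>a \<in> carrier G; b \<in> carrier G\<rbrakk> \<Longrightarrow> a \<otimes> (inv a \<otimes> b) = b"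
  using inv_mult_cancel [of "inv a" b] by simp

text \<open>Gyrations are terms in the product and the inverse, so whatever is compatible with these
  two operations is compatible with \<open>gyr\<close>.\<close>

lemma gyr_eq:
  "\<lbrakk>x \<in> carrier G; y \<in> carrier G; z \<in> carrier G\<rbrakk>
    \<Longrightarrow> gyr G x y z = inv (x \<otimes> y) \<otimes> (x \<otimes> (y \<otimes> z))"
  by (simp add: G3 [of x y z] closed gyr_closed)

text \<open>A term that undoes a gyration: this form of injectivity survives in homomorphic
  images.\<close>

lemma gyr_inverse_eq:
  "\<lbrakk>x \<in> carrier G; y \<in> carrier G; z \<in> carrier G\<rbrakk>
    \<Longrightarrow> inv y \<otimes> (inv x \<otimes> ((x \<otimes> y) \<otimes> gyr G x y z)) = z"
  using G3 [of x y z, symmetric] by (simp add: closed)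

end

section \<open>Homomorphic images of gyrogroups\<close>

text \<open>Identities pass to the image at once. Uniqueness of inverses and injectivity of
  gyrations do not have the form of identities; they follow from identities of \<open>G\<close> that
  undo the operation in question.\<close>

lemma gyrogroup_hom_image:
  fixes G :: "('a, 'm) gyro_scheme" and H :: "('b, 'n) gyro_scheme"
  assumes "gyrogroup G"
    and carr: "carrier H = p ` carrier G"
    and mult: "\<And>x y. \<lbrakk>x \<in> carrier G; y \<in> carrier G\<rbrakk> \<Longrightarrow> p x \<otimes>\<^bsub>H\<^esub> p y = p (x \<otimes>\<^bsub>G\<^esub> y)"
    and one: "\<one>\<^bsub>H\<^esub> = p \<one>\<^bsub>G\<^esub>"
    and gyr: "\<And>x y z. \<lbrakk>x \<in> carrier G; y \<in> carrier G; z \<in> carrier G\<rbrakk>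
      \<Longrightarrow> gyr H (p x) (p y) (p z) = p (gyr G x y z)"
  shows "gyrogroup H" and "\<And>x. x \<in> carrier G \<Longrightarrow> inv\<^bsub>H\<^esub> p x = p (inv\<^bsub>G\<^esub> x)"
proof -
  interpret G: gyrogroup G by fact
  note [simp] = G.closed G.gyr_closed
  show H: "gyrogroup H"
  proof
    fix e
    show "e \<in> carrier H \<and> (\<forall>a\<in>carrier H. e \<otimes>\<^bsub>H\<^esub> a = a \<and> a \<otimes>\<^bsub>H\<^esub> e = a) \<longleftrightarrow> e = \<one>\<^bsub>H\<^esub>"
    proof
      assume e: "e \<in> carrier H \<and> (\<forall>a\<in>carrier H. e \<otimes>\<^bsub>H\<^esub> a = a \<and> a \<otimes>\<^bsub>H\<^esub> e = a)"
      then obtain x where "x \<in> carrier G" "e = p x"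
        using carr by auto
      with e show "e = \<one>\<^bsub>H\<^esub>"
        using mult [of x "\<one>\<^bsub>G\<^esub>"] by (simp add: carr one)
    qed (auto simp: carr one mult)
  next
    fix c assume "c \<in> carrier H"
    then obtain x where x: "x \<in> carrier G" "c = p x"
      using carr by auto
    show "\<exists>!d. d \<in> carrier H \<and> d \<otimes>\<^bsub>H\<^esub> c = \<one>\<^bsub>H\<^esub> \<and> c \<otimes>\<^bsub>H\<^esub> d = \<one>\<^bsub>H\<^esub>"
    proof (rule ex1I [of _ "p (inv\<^bsub>G\<^esub> x)"])
      fix d assume d: "d \<in> carrier H \<and> d \<otimes>\<^bsub>H\<^esub> c = \<one>\<^bsub>H\<^esub> \<and> c \<otimes>\<^bsub>H\<^esub> d = \<one>\<^bsub>H\<^esub>"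
      then obtain y where y: "y \<in> carrier G" "d = p y"
        using carr by auto
      \<comment> \<open>Uniqueness of the inverse: left multiplication by the inverse of
        \<open>x\<close> can be carried out under \<open>p\<close>, since \<open>p\<close> respects
        products.\<close>
      have "p (x \<otimes>\<^bsub>G\<^esub> y) = p \<one>\<^bsub>G\<^esub>"
        using d x y by (simp add: mult one)
      then have "p (inv\<^bsub>G\<^esub> x \<otimes>\<^bsub>G\<^esub> (x \<otimes>\<^bsub>G\<^esub> y)) = p (inv\<^bsub>G\<^esub> x \<otimes>\<^bsub>G\<^esub> \<one>\<^bsub>G\<^esub>)"
        using x y by (metis G.closed G.inv_closed G.one_closed mult)
      then show "d = p (inv\<^bsub>G\<^esub> x)"
        using x y by simp
    qed (use x in \<open>auto simp: carr mult one\<close>)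
  next
    fix c d assume "c \<in> carrier H" "d \<in> carrier H"
    then obtain x y where xy: "x \<in> carrier G" "y \<in> carrier G" "c = p x" "d = p y"
      using carr by auto
    have "gyr H c d \<in> hom H H"
      using xy by (auto simp: hom_def carr gyr mult G.gyr_mult)
    moreover have "inj_on (gyr H c d) (carrier H)"
    proof (rule inj_onI)
      fix e e' assume "e \<in> carrier H" "e' \<in> carrier H" and eq: "gyr H c d e = gyr H c d e'"
      then obtain z z' where z: "z \<in> carrier G" "z' \<in> carrier G" "e = p z" "e' = p z'"
        using carr by auto
      \<comment> \<open>\<open>p u\<close> is expressed through the image of the gyration by
        products in \<open>H\<close>, so equal gyrations have equal arguments.\<close>
      have *: "p u = p (inv\<^bsub>G\<^esub> y) \<otimes>\<^bsub>H\<^esub> (p (inv\<^bsub>G\<^esub> x) \<otimes>\<^bsub>H\<^esub> (p (x \<otimes>\<^bsub>G\<^esub> y) \<otimes>\<^bsub>H\<^esub> p (gyr G x y u)))"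
        if "u \<in> carrier G" for u
        using that xy by (simp add: mult G.gyr_inverse_eq)
      have "p (gyr G x y z) = p (gyr G x y z')"
        using eq z xy by (simp add: gyr)
      then show "e = e'"
        using *[OF z(1)] *[OF z(2)] z(3,4) by metis
    qed
    moreover have "gyr H c d ` carrier H = carrier H"
    proof -
      have "gyr H c d ` carrier H = p ` gyr G x y ` carrier G"
        using xy by (auto simp: carr gyr image_iff)
      then show ?thesis
        using G.gyr_bij [of x y] xy by (simp add: bij_betw_def carr)
    qed
    ultimately show "gyr H c d \<in> iso H H"
      by (simp add: iso_def bij_betw_def)
  qed (auto simp: carr mult gyr G.G3 G.G4)
  interpret H: gyrogroup H by fact
  show "inv\<^bsub>H\<^esub> p x = p (inv\<^bsub>G\<^esub> x)" if "x \<in> carrier G" for x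
    by (rule H.inv_equality) (use that in \<open>auto simp: carr mult one\<close>)
qed

section \<open>Weak topologies of families of real functions\<close>

text \<open>The initial topology of \<open>F\<close> on \<open>A\<close>, taken as the pullback
  along the evaluation map into the power of the reals so that metrizability can be read off from an
  embedding.\<close>

definition weak_topology :: "'a set \<Rightarrow> ('a \<Rightarrow> real) set \<Rightarrow> 'a topology" where
  "weak_topology A F =
     pullback_topology A (\<lambda>x. \<lambda>f\<in>F. f x) (product_topology (\<lambda>_. euclideanreal) F)"

lemma topspace_weak_topology [simp]: "topspace (weak_topology A F) = A"
  by (auto simp: weak_topology_def topspace_pullback_topology)

lemma continuous_map_weak_topology:
  "continuous_map X (weak_topology A F) g \<longleftrightarrow>
     g \<in> topspace X \<rightarrow> A \<and> (\<forall>f\<in>F. continuous_map X euclideanreal (\<lambda>x. f (g x)))" (is "?L \<longleftrightarrow> ?R")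
proof
  assume L: ?L
  have "continuous_map (weak_topology A F) (product_topology (\<lambda>_. euclideanreal) F)
      (id \<circ> (\<lambda>x. \<lambda>f\<in>F. f x))"
    unfolding weak_topology_def by (intro continuous_map_pullback continuous_map_id)
  from continuous_map_compose [OF L this]
  have "\<forall>f\<in>F. continuous_map X euclideanreal (\<lambda>x. f (g x))"
    by (simp add: continuous_map_componentwise o_def)
  moreover have "g \<in> topspace X \<rightarrow> A"
    using continuous_map_funspace [OF L] by simp
  ultimately show ?R by simp
next
  assume ?R
  then show ?L
    unfolding weak_topology_def
    by (intro continuous_map_pullback') (auto simp: continuous_map_componentwise o_def)
qed

lemma continuous_map_weak_topology_mem:
  "f \<in> F \<Longrightarrow> continuous_map (weak_topology A F) euclideanreal f"
  using continuous_map_weak_topology [of "weak_topology A F" A F id] by auto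

lemma weak_topology_mono:
  assumes "F' \<subseteq> F"
  shows "continuous_map (weak_topology A F) (weak_topology A F') id"
  using assms by (auto simp: continuous_map_weak_topology intro: continuous_map_weak_topology_mem)

text \<open>More functions give a finer topology; continuity secured by a few functions therefore
  survives every later enlargement of the family.\<close>

lemma continuous_map_prod_weak_topology_mono:
  assumes g: "continuous_map (prod_topology (weak_topology A F') (weak_topology A F')) Y g"
    and "F' \<subseteq> F"
  shows "continuous_map (prod_topology (weak_topology A F) (weak_topology A F)) Y g"
proof -
  have "continuous_map (prod_topology (weak_topology A F) (weak_topology A F))
      (prod_topology (weak_topology A F') (weak_topology A F')) (\<lambda>(x, y). (id x, id y))"
    unfolding continuous_map_prod_top using weak_topology_mono [OF assms(2)] by blast
  from continuous_map_compose [OF this g] show ?thesis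
    by (simp add: o_def)
qed

lemma openin_weak_topology_less:
  assumes "f \<in> F"
  shows "openin (weak_topology A F) {x \<in> A. f x < a}"
proof -
  have "openin (weak_topology A F) {x \<in> topspace (weak_topology A F). f x \<in> {..<a}}"
    by (rule openin_continuous_map_preimage [OF continuous_map_weak_topology_mem [OF assms]]) auto
  then show ?thesis by simp
qed

text \<open>A basic open set of the product restricts finitely many coordinates, so one radius
  serves all of them. Taking it of the form \<open>1 / real (Suc n)\<close> leaves only countably
  many radii to provide for later.\<close>

lemma weak_topology_nbhd:
  assumes W: "openin (weak_topology A F) W" and x: "x \<in> W"
  obtains K and n :: nat where "finite K" "K \<subseteq> F"
    "{y \<in> A. \<forall>f\<in>K. \<bar>f y - f x\<bar> < 1 / real (Suc n)} \<subseteq> W"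
proof -
  let ?E = "\<lambda>x. \<lambda>f\<in>F. f x"
  obtain O' where O': "openin (product_topology (\<lambda>_. euclideanreal) F) O'" "W = ?E -` O' \<inter> A"
    using W by (auto simp: weak_topology_def openin_pullback_topology)
  with x obtain I where I: "finite {f \<in> F. I f \<noteq> UNIV}" "\<And>f. f \<in> F \<Longrightarrow> open (I f)"
      "?E x \<in> Pi\<^sub>E F I" "Pi\<^sub>E F I \<subseteq> O'"
    unfolding openin_product_topology_alt by (auto simp flip: open_openin)
  let ?K = "{f \<in> F. I f \<noteq> UNIV}"
  \<comment> \<open>The common radius is a minimum built up by induction on the finite set; the
    empty set gets radius 1.\<close>
  have "\<exists>e>0. \<forall>f\<in>?K. \<forall>y. \<bar>y - f x\<bar> < e \<longrightarrow> y \<in> I f"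
    using I(1)
  proof (rule finite_induct [where P = "\<lambda>K. K \<subseteq> F \<longrightarrow> (\<exists>e>0. \<forall>f\<in>K. \<forall>y. \<bar>y - f x\<bar> < e \<longrightarrow> y \<in> I f)",
        THEN mp])
    fix g K
    assume IH: "K \<subseteq> F \<longrightarrow> (\<exists>e>0. \<forall>f\<in>K. \<forall>y. \<bar>y - f x\<bar> < e \<longrightarrow> y \<in> I f)"
    show "insert g K \<subseteq> F \<longrightarrow> (\<exists>e>0. \<forall>f\<in>insert g K. \<forall>y. \<bar>y - f x\<bar> < e \<longrightarrow> y \<in> I f)"
    proof
      assume *: "insert g K \<subseteq> F"
      with IH obtain d where d: "d > 0" "\<forall>f\<in>K. \<forall>y. \<bar>y - f x\<bar> < d \<longrightarrow> y \<in> I f"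
        by auto
      have "g x \<in> I g" "open (I g)"
        using I(2,3) * by (auto simp: PiE_iff)
      then obtain d' where "d' > 0" "\<forall>y. \<bar>y - g x\<bar> < d' \<longrightarrow> y \<in> I g"
        by (auto simp: open_dist dist_real_def)
      with d show "\<exists>e>0. \<forall>f\<in>insert g K. \<forall>y. \<bar>y - f x\<bar> < e \<longrightarrow> y \<in> I f"
        by (intro exI [of _ "min d d'"]) auto
    qed
  qed (auto intro: exI [of _ 1])
  then obtain e where e: "e > 0" "\<And>f y. f \<in> ?K \<Longrightarrow> \<bar>y - f x\<bar> < e \<Longrightarrow> y \<in> I f"
    by blast
  obtain n where n: "1 / real (Suc n) < e"
    using e(1) nat_approx_posE by metis
  have "{y \<in> A. \<forall>f\<in>?K. \<bar>f y - f x\<bar> < 1 / real (Suc n)} \<subseteq> W"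
  proof clarify
    fix y assume y: "y \<in> A" "\<forall>f\<in>?K. \<bar>f y - f x\<bar> < 1 / real (Suc n)"
    have "f y \<in> I f" if "f \<in> F" for f
    proof (cases "I f = UNIV")
      case False
      then have "f \<in> ?K" using that by auto
      with y(2) n have "\<bar>f y - f x\<bar> < e" by force
      then show ?thesis using e(2) \<open>f \<in> ?K\<close> by blast
    qed auto
    then have "?E y \<in> Pi\<^sub>E F I" by auto
    then have "?E y \<in> O'" using I(4) by blast
    then show "y \<in> W" using O'(2) y(1) by blast
  qed
  with I(1) show thesis
    by (intro that [of ?K n]) auto
qed

text \<open>Since \<open>F\<close> separates points, evaluation is an embedding into a countable
  product of real lines, which is metrizable.\<close>

lemma metrizable_weak_topology:
  assumes "countable F"
    and sep: "\<And>x y. \<lbrakk>x \<in> A; y \<in> A; \<forall>f\<in>F. f x = f y\<rbrakk> \<Longrightarrow> x = y"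
  shows "metrizable_space (weak_topology A F)"
proof -
  let ?E = "\<lambda>x. \<lambda>f\<in>F. f x" and ?P = "product_topology (\<lambda>_. euclideanreal) F"
  have inj: "inj_on ?E A"
  proof (rule inj_onI)
    fix x y assume xy: "x \<in> A" "y \<in> A" "?E x = ?E y"
    have "f x = f y" if "f \<in> F" for f
      using fun_cong [OF xy(3), of f] that by simp
    then show "x = y" using sep xy by blast
  qed
  have inv: "?E (inv_into A ?E z) = z" if "z \<in> ?E ` A" for z
    by (rule f_inv_into_f [OF that])
  have inv': "inv_into A ?E (?E x) = x" if "x \<in> A" for x
    by (rule inv_into_f_f [OF inj that])
  have "metrizable_space ?P"
    using assms(1) unfolding metrizable_space_product_topology
    by (auto intro!: disjI2 metrizable_space_euclidean countable_subset [OF _ assms(1)])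
  then have "metrizable_space (subtopology ?P (?E ` A))"
    by (rule metrizable_space_subtopology)
  moreover have "homeomorphic_maps (weak_topology A F) (subtopology ?P (?E ` A)) ?E (inv_into A ?E)"
    unfolding homeomorphic_maps_def
  proof (intro conjI ballI)
    show "continuous_map (weak_topology A F) (subtopology ?P (?E ` A)) ?E"
      by (auto simp: continuous_map_in_subtopology continuous_map_componentwise
          intro: continuous_map_weak_topology_mem)
    show "continuous_map (subtopology ?P (?E ` A)) (weak_topology A F) (inv_into A ?E)"
      unfolding weak_topology_def
    proof (rule continuous_map_pullback')
      show "continuous_map (subtopology ?P (?E ` A)) ?P (?E \<circ> inv_into A ?E)"
        by (rule continuous_map_eq [of _ _ id])
          (use inv in \<open>simp_all add: continuous_map_from_subtopology\<close>)
      show "topspace (subtopology ?P (?E ` A)) \<subseteq> inv_into A ?E -` A"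
      proof
        fix z assume "z \<in> topspace (subtopology ?P (?E ` A))"
        then have "z \<in> ?E ` A" by simp
        then show "z \<in> inv_into A ?E -` A" by (simp add: inv_into_into)
      qed
    qed
  qed (use inv inv' in simp_all)
  ultimately show ?thesis
    using homeomorphic_metrizable_space homeomorphic_maps_imp_homeomorphic_space by blast
qed

lemma openin_weak_topology_indistinguishable:
  assumes W: "openin (weak_topology A F) W" and x: "x \<in> W"
    and y: "y \<in> A" "\<And>f. f \<in> F \<Longrightarrow> f y = f x"
  shows "y \<in> W"
proof -
  obtain K and n :: nat where K: "finite K" "K \<subseteq> F"
    "{z \<in> A. \<forall>f\<in>K. \<bar>f z - f x\<bar> < 1 / real (Suc n)} \<subseteq> W"
    by (rule weak_topology_nbhd [OF W x])
  have "\<bar>f y - f x\<bar> < 1 / real (Suc n)" if "f \<in> K" for f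
    using y(2) [of f] K(2) that by auto
  with K(3) y(1) show ?thesis by blast
qed

text \<open>Disjoint open sets around two different values would have preimages separating
  \<open>x\<close> from \<open>y\<close>, which no open set of the weak topology does. This makes
  the operations well defined on the quotient.\<close>

lemma continuous_map_weak_topology_indistinguishable:
  assumes g: "continuous_map (weak_topology A F) Y g" and "Hausdorff_space Y"
    and xy: "x \<in> A" "y \<in> A" "\<And>f. f \<in> F \<Longrightarrow> f y = f x"
  shows "g y = g x"
proof (rule ccontr)
  assume "g y \<noteq> g x"
  moreover have "g x \<in> topspace Y" "g y \<in> topspace Y"
    using g xy by (auto simp: continuous_map_def)
  ultimately obtain U V where U: "openin Y U" "openin Y V" "g x \<in> U" "g y \<in> V" "disjnt U V"
    using \<open>Hausdorff_space Y\<close> unfolding Hausdorff_space_def by metis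
  have "openin (weak_topology A F) {z \<in> A. g z \<in> U}"
    using openin_continuous_map_preimage [OF g U(1)] by simp
  from openin_weak_topology_indistinguishable [OF this, of x y] have "g y \<in> U"
    using U(3) xy by auto
  with U show False by (auto simp: disjnt_iff)
qed

section \<open>Continuous real functions on a Lindelof square\<close>

text \<open>Boxes are coded by pairs of functions, so that a countable cover by boxes yields a
  countable set of functions.\<close>

definition unit_box :: "'a topology \<Rightarrow> ('a \<Rightarrow> real) \<times> ('a \<Rightarrow> real) \<Rightarrow> ('a \<times> 'a) set" where
  "unit_box X m = {x \<in> topspace X. fst m x < 1} \<times> {x \<in> topspace X. snd m x < 1}"

lemma Lindelof_prod_small_oscillation:
  fixes X :: "'a topology" and g :: "'a \<times> 'a \<Rightarrow> real"
  assumes L: "Lindelof_space (prod_topology X X)" and cr: "completely_regular_space X"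
    and g: "continuous_map (prod_topology X X) euclideanreal g" and "e > 0"
  shows "\<exists>M. countable M \<and> topspace (prod_topology X X) \<subseteq> \<Union> (unit_box X ` M) \<and>
    (\<forall>m\<in>M. continuous_map X euclideanreal (fst m) \<and> continuous_map X euclideanreal (snd m) \<and>
      (\<forall>p\<in>unit_box X m. \<forall>q\<in>unit_box X m. \<bar>g p - g q\<bar> < e))"
proof -
  define N where "N = {m. continuous_map X euclideanreal (fst m) \<and> continuous_map X euclideanreal (snd m) \<and>
      (\<forall>p\<in>unit_box X m. \<forall>q\<in>unit_box X m. \<bar>g p - g q\<bar> < e)}"
  have op: "openin (prod_topology X X) (unit_box X m)" if m: "m \<in> N" for m
  proof -
    have "openin X {x \<in> topspace X. u x \<in> {..<1}}" if "continuous_map X euclideanreal u"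
      for u :: "'a \<Rightarrow> real"
      by (rule openin_continuous_map_preimage [OF that]) auto
    with m show ?thesis
      by (auto simp: unit_box_def N_def openin_prod_Times_iff)
  qed
  have "\<exists>m\<in>N. p \<in> unit_box X m" if p: "p \<in> topspace (prod_topology X X)" for p
  proof -
    obtain a b where ab: "p = (a, b)" by force
    \<comment> \<open>Half of \<open>e\<close>, because two points of the box are compared through
      the value at \<open>p\<close>.\<close>
    define W where "W = {q \<in> topspace (prod_topology X X). g q \<in> ball (g p) (e / 2)}"
    have "openin (prod_topology X X) W"
      unfolding W_def by (intro openin_continuous_map_preimage [OF g]) auto
    moreover have "(a, b) \<in> W" using p \<open>e > 0\<close> ab by (auto simp: W_def)
    ultimately obtain U V where UV: "openin X U" "openin X V" "a \<in> U" "b \<in> V" "U \<times> V \<subseteq> W"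
      unfolding openin_prod_topology_alt by meson
    \<comment> \<open>\<open>u\<close> vanishes at \<open>a\<close> and is 1 off \<open>U\<close>,
      so \<open>{u < 1}\<close> is a neighbourhood of \<open>a\<close> inside \<open>U\<close>;
      \<open>v\<close> does the same for \<open>b\<close> and \<open>V\<close>.\<close>
    obtain u where u: "continuous_map X euclideanreal u" "u a = 0" "u ` (topspace X - U) \<subseteq> {1}"
      using cr UV unfolding completely_regular_space_alt' by meson
    obtain v where v: "continuous_map X euclideanreal v" "v b = 0" "v ` (topspace X - V) \<subseteq> {1}"
      using cr UV unfolding completely_regular_space_alt' by meson
    have "x \<in> U" if "x \<in> topspace X" "u x < 1" for x
      using u(3) that by (metis Diff_iff image_subset_iff less_irrefl singletonD)
    moreover have "x \<in> V" if "x \<in> topspace X" "v x < 1" for x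
      using v(3) that by (metis Diff_iff image_subset_iff less_irrefl singletonD)
    ultimately have "unit_box X (u, v) \<subseteq> U \<times> V"
      by (auto simp: unit_box_def)
    then have RW: "unit_box X (u, v) \<subseteq> W" using UV by blast
    have "\<bar>g q - g q'\<bar> < e" if "q \<in> unit_box X (u, v)" "q' \<in> unit_box X (u, v)" for q q'
    proof -
      have "dist (g p) (g q) < e / 2" "dist (g p) (g q') < e / 2"
        using that RW by (auto simp: W_def)
      then show ?thesis by (simp add: dist_real_def abs_if split: if_splits)
    qed
    with u(1) v(1) have "(u, v) \<in> N" by (simp add: N_def)
    moreover have "p \<in> unit_box X (u, v)" using u v p ab by (auto simp: unit_box_def)
    ultimately show ?thesis by blast
  qed
  then have "topspace (prod_topology X X) \<subseteq> \<Union> (unit_box X ` N)" by blast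
  moreover have "\<forall>W\<in>unit_box X ` N. openin (prod_topology X X) W" using op by blast
  ultimately obtain V where V: "countable V" "V \<subseteq> unit_box X ` N" "topspace (prod_topology X X) \<subseteq> \<Union> V"
    using L unfolding Lindelof_space_alt by meson
  \<comment> \<open>One code is chosen for each box of the countable subcover.\<close>
  obtain M where M: "countable M" "M \<subseteq> N" "V = unit_box X ` M"
    using V(1,2) countable_subset_image by metis
  have "\<forall>m\<in>M. m \<in> N" using M(2) by blast
  with M(1,3) V(3) show ?thesis
    unfolding N_def mem_Collect_eq by blast
qed

lemma Lindelof_prod_real_factor:
  fixes X :: "'a topology" and g :: "'a \<times> 'a \<Rightarrow> real"
  assumes L: "Lindelof_space (prod_topology X X)" and cr: "completely_regular_space X"
    and g: "continuous_map (prod_topology X X) euclideanreal g"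
  obtains F where "countable F" "\<And>f. f \<in> F \<Longrightarrow> continuous_map X euclideanreal f"
    "continuous_map (prod_topology (weak_topology (topspace X) F) (weak_topology (topspace X) F))
       euclideanreal g"
proof -
  have "\<exists>M. countable M \<and> topspace (prod_topology X X) \<subseteq> \<Union> (unit_box X ` M) \<and>
    (\<forall>m\<in>M. continuous_map X euclideanreal (fst m) \<and> continuous_map X euclideanreal (snd m) \<and>
      (\<forall>p\<in>unit_box X m. \<forall>q\<in>unit_box X m. \<bar>g p - g q\<bar> < 1 / real (Suc n)))" for n
    by (rule Lindelof_prod_small_oscillation [OF L cr g]) simp
  then obtain M where M: "\<And>n. countable (M n)"
    "\<And>n. topspace (prod_topology X X) \<subseteq> \<Union> (unit_box X ` M n)"
    "\<And>n. \<forall>m\<in>M n. continuous_map X euclideanreal (fst m) \<and> continuous_map X euclideanreal (snd m) \<and>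
      (\<forall>p\<in>unit_box X m. \<forall>q\<in>unit_box X m. \<bar>g p - g q\<bar> < 1 / real (Suc n))"
    by metis
  define F where "F = (\<Union>n. fst ` M n \<union> snd ` M n)"
  let ?w = "weak_topology (topspace X) F"
  show thesis
  proof (rule that [of F])
    show "countable F" using M(1) by (auto simp: F_def)
    show "continuous_map X euclideanreal f" if "f \<in> F" for f
      using that M(3) unfolding F_def by blast
    \<comment> \<open>Continuity at \<open>p\<close>: the neighbourhood is a box of level
      \<open>n\<close> containing \<open>p\<close>, open in the weak topology because both its
      functions belong to \<open>F\<close>.\<close>
    have "\<exists>U. openin (prod_topology ?w ?w) U \<and> p \<in> U \<and> (\<forall>q\<in>U. g q \<in> ball (g p) e)"
      if p: "p \<in> topspace X \<times> topspace X" and "e > 0" for p and e :: real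
    proof -
      obtain n where n: "1 / real (Suc n) < e"
        using \<open>e > 0\<close> nat_approx_posE by metis
      have "p \<in> \<Union> (unit_box X ` M n)"
        using M(2) [of n] p by auto
      then obtain m where m: "m \<in> M n" "p \<in> unit_box X m"
        by blast
      then have "fst m \<in> F" "snd m \<in> F" unfolding F_def by blast+
      then have "openin (prod_topology ?w ?w) (unit_box X m)"
        by (simp add: unit_box_def openin_prod_Times_iff openin_weak_topology_less)
      moreover have "g q \<in> ball (g p) e" if "q \<in> unit_box X m" for q
      proof -
        have "\<bar>g p - g q\<bar> < 1 / real (Suc n)" using M(3) m that by blast
        with n show ?thesis by (simp add: dist_real_def)
      qed
      ultimately show ?thesis
        using m(2) by blast
    qed
    then show "continuous_map (prod_topology ?w ?w) euclideanreal g"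
      unfolding Met_TC.continuous_map_to_metric [unfolded mtopology_is_euclidean mball_eq_ball]
      by simp
  qed
qed

section \<open>The quotient by a countable family of functions\<close>

text \<open>With the topology \<open>w\<close>, \<open>G\<close> may lack only the separation axiom;
  \<open>H\<close> is its Kolmogorov quotient. Open sets of \<open>w\<close> are saturated, hence
  the last conclusion, which later carries a neighbourhood inside \<open>U\<close> over to
  \<open>H\<close>.\<close>

lemma (in gyrogroup) weak_topology_quotient:
  fixes F :: "('a \<Rightarrow> real) set"
  defines "w \<equiv> weak_topology (carrier G) F"
  assumes "countable F"
    and mult: "continuous_map (prod_topology w w) w (\<lambda>(x, y). x \<otimes> y)"
    and inv: "continuous_map w w (m_inv G)"
    and base: "gyr_invariant_base G w \<B>"
  obtains H :: "'a set gyro" and S and p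
  where "strongly_topological_gyrogroup H S" "metrizable_space S"
    "p \<in> hom G H" "p ` carrier G = carrier H" "continuous_map w S p" "p \<one> = \<one>\<^bsub>H\<^esub>"
    "\<And>W. openin w W \<Longrightarrow> \<exists>V. openin S V \<and> W = {x \<in> carrier G. p x \<in> V}"
proof -
  define p where "p x = {y \<in> carrier G. \<forall>f\<in>F. f y = f x}" for x
  \<comment> \<open>\<open>s\<close> chooses a representative of each class. Members of
    \<open>F\<close> are constant on classes, so \<open>f (s c)\<close> is the function induced by
    \<open>f\<close> on the quotient, whatever the choice.\<close>
  define s where "s = inv_into (carrier G) p"
  define S where "S = weak_topology (p ` carrier G) ((\<lambda>f x. f (s x)) ` F)"
  have p_eq: "p x = p y \<longleftrightarrow> (\<forall>f\<in>F. f x = f y)" if "x \<in> carrier G" "y \<in> carrier G" for x y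
    using that unfolding p_def by (auto simp: set_eq_iff)
  have s: "s c \<in> carrier G" "p (s c) = c" if "c \<in> p ` carrier G" for c
    using that by (auto simp: s_def inv_into_into f_inv_into_f)
  have sp: "s (p x) \<in> carrier G" "p (s (p x)) = p x" if "x \<in> carrier G" for x
    using that s by blast+
  have f_sp: "f (s (p x)) = f x" if "x \<in> carrier G" "f \<in> F" for x f
    using that p_eq sp by blast
  have contS: "continuous_map X S g \<longleftrightarrow> g \<in> topspace X \<rightarrow> p ` carrier G \<and>
      (\<forall>f\<in>F. continuous_map X euclideanreal (\<lambda>x. f (s (g x))))" for X :: "'x topology" and g
    by (simp add: S_def continuous_map_weak_topology)
  have top: "topspace w = carrier G" "topspace S = p ` carrier G"
    by (simp_all add: w_def S_def)
  have p_cont: "continuous_map w S p"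
    unfolding contS
  proof (intro conjI ballI)
    fix f assume f: "f \<in> F"
    show "continuous_map w euclideanreal (\<lambda>x. f (s (p x)))"
    proof (rule continuous_map_eq)
      show "continuous_map w euclideanreal f"
        unfolding w_def by (rule continuous_map_weak_topology_mem [OF f])
    qed (simp add: f_sp [OF _ f] top)
  qed (simp add: top)
  \<comment> \<open>The arbitrary section \<open>s\<close> is continuous, because \<open>S\<close>
    is the weak topology of the functions \<open>f (s c)\<close>.\<close>
  have s_cont: "continuous_map S w s"
    unfolding w_def continuous_map_weak_topology
  proof (intro conjI ballI)
    fix f assume "f \<in> F"
    then show "continuous_map S euclideanreal (\<lambda>x. f (s x))"
      unfolding S_def by (intro continuous_map_weak_topology_mem imageI)
  qed (simp add: top s)
  have metr: "metrizable_space S"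
    unfolding S_def
  proof (rule metrizable_weak_topology)
    fix c d assume cd: "c \<in> p ` carrier G" "d \<in> p ` carrier G" "\<forall>f\<in>(\<lambda>f x. f (s x)) ` F. f c = f d"
    then have "\<forall>f\<in>F. f (s c) = f (s d)" by simp
    then have "p (s c) = p (s d)"
      using p_eq [OF s(1) [OF cd(1)] s(1) [OF cd(2)]] by blast
    then show "c = d" using cd(1,2) s(2) by metis
  qed (use \<open>countable F\<close> in auto)
  then have Haus: "Hausdorff_space S"
    by (rule metrizable_imp_Hausdorff_space)
  have cong: "g x = g y"
    if g: "continuous_map w S g" and xy: "x \<in> carrier G" "y \<in> carrier G" and "p x = p y" for g x y
  proof (rule continuous_map_weak_topology_indistinguishable [OF g [unfolded w_def] Haus xy(2,1)])
    show "f x = f y" if "f \<in> F" for f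
      using p_eq [OF xy] \<open>p x = p y\<close> that by blast
  qed
  \<comment> \<open>One factor is changed at a time: with the other one fixed, the product followed
    by \<open>p\<close> is a continuous map from \<open>w\<close> to a Hausdorff space.\<close>
  have mult_cong: "p (x \<otimes> y) = p (x' \<otimes> y')"
    if xy: "x \<in> carrier G" "y \<in> carrier G" "x' \<in> carrier G" "y' \<in> carrier G"
      and eq: "p x = p x'" "p y = p y'"
    for x y x' y'
  proof -
    have cont: "continuous_map w S (\<lambda>z. p (f z \<otimes> g z))"
      if "continuous_map w w f" "continuous_map w w g" for f g
      using continuous_map_compose [OF continuous_map_compose
          [OF continuous_map_pairedI [OF that] mult] p_cont]
      by (simp add: o_def)
    have "p (x \<otimes> y) = p (x' \<otimes> y)"
      by (rule cong [OF cont [of "\<lambda>z. z" "\<lambda>z. y"] xy(1,3) eq(1)]) (simp_all add: top xy)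
    also have "\<dots> = p (x' \<otimes> y')"
      by (rule cong [OF cont [of "\<lambda>z. x'" "\<lambda>z. z"] xy(2,4) eq(2)]) (simp_all add: top xy)
    finally show ?thesis .
  qed
  have inv_cong: "p (inv x) = p (inv x')" if "x \<in> carrier G" "x' \<in> carrier G" "p x = p x'" for x x'
    using cong [OF continuous_map_compose [OF inv p_cont] that] by simp
  define H :: "'a set gyro" where "H = \<lparr>carrier = p ` carrier G,
    mult = (\<lambda>c d. p (s c \<otimes> s d)), one = p \<one>,
    gyr = (\<lambda>c d e. p (gyr G (s c) (s d) (s e)))\<rparr>"
  have H_simps [simp]: "carrier H = p ` carrier G" "\<one>\<^bsub>H\<^esub> = p \<one>"
    by (simp_all add: H_def)
  have H_mult: "p x \<otimes>\<^bsub>H\<^esub> p y = p (x \<otimes> y)" if "x \<in> carrier G" "y \<in> carrier G" for x y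
  proof -
    have "p (s (p x) \<otimes> s (p y)) = p (x \<otimes> y)"
      by (rule mult_cong) (simp_all add: sp that)
    then show ?thesis by (simp add: H_def)
  qed
  have H_gyr: "gyr H (p x) (p y) (p z) = p (gyr G x y z)"
    if "x \<in> carrier G" "y \<in> carrier G" "z \<in> carrier G" for x y z
  proof -
    \<comment> \<open>By \<open>gyr_eq\<close> both gyrations are terms in the operations, for which
      congruence is already known.\<close>
    have "p (inv (s (p x) \<otimes> s (p y)) \<otimes> (s (p x) \<otimes> (s (p y) \<otimes> s (p z))))
        = p (inv (x \<otimes> y) \<otimes> (x \<otimes> (y \<otimes> z)))"
      by (intro mult_cong inv_cong) (simp_all add: sp that closed)
    then show ?thesis by (simp add: H_def gyr_eq sp that)
  qed
  note H = gyrogroup_hom_image [OF gyrogroup_axioms H_simps(1) H_mult H_simps(2) H_gyr]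
  have sat: "\<exists>V. openin S V \<and> W = {x \<in> carrier G. p x \<in> V}" if W: "openin w W" for W
  proof (intro exI conjI)
    \<comment> \<open>The witness is the preimage of \<open>W\<close> under the section; saturation
      of \<open>W\<close> gives \<open>x \<in> W\<close> exactly when
      \<open>s (p x) \<in> W\<close>.\<close>
    show "openin S {c \<in> topspace S. s c \<in> W}"
      by (rule openin_continuous_map_preimage [OF s_cont W])
    have "x \<in> W \<longleftrightarrow> s (p x) \<in> W" if "x \<in> carrier G" for x
      using openin_weak_topology_indistinguishable [OF W [unfolded w_def], of x "s (p x)"]
        openin_weak_topology_indistinguishable [OF W [unfolded w_def], of "s (p x)" x] that sp f_sp
      by metis
    then show "W = {x \<in> carrier G. p x \<in> {c \<in> topspace S. s c \<in> W}}"
      using openin_subset [OF W] by (auto simp: top)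
  qed
  have str: "strongly_topological_gyrogroup H S"
  proof (intro strongly_topological_gyrogroup.intro topological_gyrogroup.intro
      topological_gyrogroup_axioms.intro strongly_topological_gyrogroup_axioms.intro H(1))
    show "topspace S = carrier H" by (simp add: top)
    show "Hausdorff_space S" by fact
    have "continuous_map (prod_topology S S) (prod_topology w w) (\<lambda>(c, d). (s c, s d))"
      using s_cont by (simp add: continuous_map_prod_top)
    from continuous_map_compose [OF continuous_map_compose [OF this mult] p_cont]
    show "continuous_map (prod_topology S S) S (\<lambda>(c, d). c \<otimes>\<^bsub>H\<^esub> d)"
      by (simp add: H_def o_def case_prod_unfold)
    show "continuous_map S S (m_inv H)"
    proof (rule continuous_map_eq)
      show "continuous_map S S (p \<circ> (m_inv G \<circ> s))"
        by (intro continuous_map_compose [OF _ p_cont] continuous_map_compose [OF s_cont inv])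
      show "(p \<circ> (m_inv G \<circ> s)) c = inv\<^bsub>H\<^esub> c" if "c \<in> topspace S" for c
        using that H(2) [of "s c"] s [of c] by (simp add: top)
    qed
    show "\<exists>\<B>. gyr_invariant_base H S \<B>"
    proof (intro exI [of _ "(`) p ` \<B>"])
      show "gyr_invariant_base H S ((`) p ` \<B>)"
        unfolding gyr_invariant_base_def is_nbhd_base_def
      proof (intro conjI ballI allI impI)
        fix B' assume "B' \<in> (`) p ` \<B>"
        then obtain B where B: "B \<in> \<B>" "B' = p ` B" by blast
        then have BG: "B \<subseteq> carrier G"
          using base by (auto simp: gyr_invariant_base_def is_nbhd_base_def top)
        then show "B' \<subseteq> topspace S" using B by (auto simp: top)
        obtain W where W: "openin w W" "\<one> \<in> W" "W \<subseteq> B"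
          using base B(1) by (auto simp: gyr_invariant_base_def is_nbhd_base_def)
        \<comment> \<open>The image of \<open>B\<close> is a neighbourhood because \<open>W\<close>
          is the full preimage of an open \<open>V\<close>, and surjectivity of \<open>p\<close>
          puts \<open>V\<close> inside the image of \<open>W\<close>.\<close>
        obtain V where V: "openin S V" "W = {x \<in> carrier G. p x \<in> V}"
          using sat W(1) by blast
        have "V \<subseteq> p ` W"
          using openin_subset [OF V(1)] V(2) by (auto simp: top)
        then show "\<exists>V. openin S V \<and> \<one>\<^bsub>H\<^esub> \<in> V \<and> V \<subseteq> B'"
          using V W B by (intro exI [of _ V]) auto
        fix c d assume "c \<in> carrier H" "d \<in> carrier H"
        then obtain x y where xy: "x \<in> carrier G" "y \<in> carrier G" "c = p x" "d = p y" by auto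
        have "gyr H c d ` B' = p ` (gyr G x y ` B)"
          unfolding B(2) image_image xy(3,4)
          by (rule image_cong) (use xy BG H_gyr in auto)
        also have "gyr G x y ` B = B"
          using base B(1) xy by (auto simp: gyr_invariant_base_def)
        finally show "gyr H c d ` B' = B'" using B by simp
      next
        fix V assume V: "openin S V \<and> \<one>\<^bsub>H\<^esub> \<in> V"
        have "openin w {x \<in> topspace w. p x \<in> V}"
          using V by (intro openin_continuous_map_preimage [OF p_cont]) auto
        moreover have "\<one> \<in> {x \<in> topspace w. p x \<in> V}" using V by (simp add: top)
        ultimately obtain B where "B \<in> \<B>" "B \<subseteq> {x \<in> topspace w. p x \<in> V}"
          using base unfolding gyr_invariant_base_def is_nbhd_base_def by meson
        then show "\<exists>B'\<in>(`) p ` \<B>. B' \<subseteq> V" by blast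
      qed
    qed
  qed
  show thesis
    by (rule that [OF str metr _ _ p_cont _ sat]) (auto simp: hom_def H_mult closed)
qed

section \<open>Closing a family of functions under the gyrogroup operations\<close>

text \<open>Chosen witness sets are added in countably many stages; the witness set of a member of
  one stage lies in the next.\<close>

lemma countable_closure_operation:
  assumes "a \<in> C"
    and step: "\<And>f. f \<in> C \<Longrightarrow> \<exists>D. countable D \<and> D \<subseteq> C \<and> P f D"
  obtains F where "countable F" "F \<subseteq> C" "a \<in> F" "\<And>f. f \<in> F \<Longrightarrow> \<exists>D\<subseteq>F. P f D"
proof -
  obtain \<Phi> where \<Phi>: "\<And>f. f \<in> C \<Longrightarrow> countable (\<Phi> f) \<and> \<Phi> f \<subseteq> C \<and> P f (\<Phi> f)"
    using step by metis
  define E where "E n = ((\<lambda>D. \<Union> (\<Phi> ` D)) ^^ n) {a}" for n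
  have E: "countable (E n) \<and> E n \<subseteq> C" for n
  proof (induction n)
    case 0
    then show ?case using assms(1) by (simp add: E_def)
  next
    case (Suc n)
    moreover have "E (Suc n) = \<Union> (\<Phi> ` E n)" by (simp add: E_def)
    ultimately show ?case using \<Phi> by (auto intro!: countable_UN)
  qed
  show thesis
  proof (rule that [of "\<Union> (range E)"])
    show "countable (\<Union> (range E))" "\<Union> (range E) \<subseteq> C" using E by auto
    have "a \<in> E 0" by (simp add: E_def)
    then show "a \<in> \<Union> (range E)" by blast
    fix f assume "f \<in> \<Union> (range E)"
    then obtain n where "f \<in> E n" by blast
    moreover have "\<Phi> f \<subseteq> E (Suc n)" using \<open>f \<in> E n\<close> by (auto simp: E_def)
    ultimately show "\<exists>D\<subseteq>\<Union> (range E). P f D"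
      using \<Phi> E by blast
  qed
qed

section \<open>Continuity rules and regularity of topological gyrogroups\<close>

context topological_gyrogroup
begin

lemma continuous_map_mult [continuous_intros]:
  assumes "continuous_map X T f" "continuous_map X T g"
  shows "continuous_map X T (\<lambda>x. f x \<otimes> g x)"
  using continuous_map_compose [OF continuous_map_pairedI [OF assms] continuous_mult]
  by (simp add: o_def)

lemma continuous_map_inv [continuous_intros]:
  assumes "continuous_map X T f"
  shows "continuous_map X T (\<lambda>x. inv f x)"
  using continuous_map_compose [OF assms continuous_inverse] by (simp add: o_def)

text \<open>For \<open>v\<close>, \<open>w\<close> in a small neighbourhood \<open>V\<close> of the
  identity, \<open>(a \<otimes> v) \<otimes> w\<close> avoids \<open>C\<close>. The left translate
  of \<open>V\<close> by \<open>a\<close> has closure disjoint from \<open>C\<close>, since points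
  of this closure have that form.\<close>

lemma regular_space: "regular_space T"
  unfolding regular_space
proof clarify
  fix C a assume C: "closedin T C" and a: "a \<in> topspace T" "a \<notin> C"
  have aG: "a \<in> carrier G" using a topspace by simp
  define W where
    "W = {p \<in> topspace (prod_topology T T). (a \<otimes> fst p) \<otimes> snd p \<in> topspace T - C}"
  have "continuous_map (prod_topology T T) T (\<lambda>p. (a \<otimes> fst p) \<otimes> snd p)"
    using aG topspace
    by (intro continuous_intros) (auto intro: continuous_map_fst continuous_map_snd)
  then have "openin (prod_topology T T) W"
    unfolding W_def by (rule openin_continuous_map_preimage) (use C in blast)
  moreover have "(\<one>, \<one>) \<in> W"
    using a aG topspace by (simp add: W_def)
  ultimately obtain V1 V2 where V12: "openin T V1" "openin T V2" "\<one> \<in> V1" "\<one> \<in> V2" "V1 \<times> V2 \<subseteq> W"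
    unfolding openin_prod_topology_alt by meson
  define V where "V = V1 \<inter> V2"
  have V: "openin T V" "\<one> \<in> V" "V \<times> V \<subseteq> W"
    using V12 by (auto simp: V_def)
  define U where "U = {x \<in> topspace T. inv a \<otimes> x \<in> V}"
  show "\<exists>U. openin T U \<and> a \<in> U \<and> disjnt C (T closure_of U)"
  proof (intro exI conjI)
    show "openin T U"
      unfolding U_def
      by (rule openin_continuous_map_preimage [OF _ V(1)])
        (use aG topspace in \<open>auto intro!: continuous_intros\<close>)
    show "a \<in> U" using a aG V by (simp add: U_def)
    have "z \<notin> C" if z: "z \<in> T closure_of U" for z
    proof -
      have zG: "z \<in> carrier G" using z closure_of_subset_topspace topspace by fastforce
      \<comment> \<open>\<open>N\<close> is a neighbourhood of \<open>z\<close> because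
        \<open>inv z \<otimes> z\<close> is the identity, so it meets \<open>U\<close>.\<close>
      define N where "N = {y \<in> topspace T. inv y \<otimes> z \<in> V}"
      have "openin T N"
        unfolding N_def
        by (rule openin_continuous_map_preimage [OF _ V(1)])
          (use zG topspace in \<open>auto intro!: continuous_intros\<close>)
      moreover have "z \<in> N" using zG V topspace by (simp add: N_def)
      moreover have "\<forall>N. z \<in> N \<and> openin T N \<longrightarrow> (\<exists>y. y \<in> U \<and> y \<in> N)"
        using z by (simp add: in_closure_of)
      ultimately obtain y where "y \<in> U" "y \<in> N"
        by blast
      then have y: "y \<in> carrier G" "inv a \<otimes> y \<in> V" "inv y \<otimes> z \<in> V"
        using topspace by (auto simp: U_def N_def)
      \<comment> \<open>By left cancellation \<open>z\<close> equals \<open>(a \<otimes> (inv a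
        \<otimes> y)) \<otimes> (inv y \<otimes> z)\<close>.\<close>
      then have "(inv a \<otimes> y, inv y \<otimes> z) \<in> W"
        using V(3) by blast
      with y(1) aG zG show ?thesis by (simp add: W_def)
    qed
    then show "disjnt C (T closure_of U)" by (auto simp: disjnt_iff)
  qed
qed

end

section \<open>Countable sets of functions that control a given function\<close>

context gyrogroup
begin

text \<open>Once \<open>g\<close> is in the family, \<open>B\<close> becomes a neighbourhood of the
  identity for the weak topology, while staying inside a basic neighbourhood given by
  \<open>f\<close>.\<close>

definition squeezes :: "('a \<Rightarrow> real) \<Rightarrow> nat \<Rightarrow> 'a set \<Rightarrow> ('a \<Rightarrow> real) \<Rightarrow> bool" where
  "squeezes f n B g \<longleftrightarrow> g \<one> < 1 \<and> {x \<in> carrier G. g x < 1} \<subseteq> B \<and>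
     B \<subseteq> {x. \<bar>f x - f \<one>\<bar> < 1 / real (Suc n)}"

text \<open>The closure condition for \<open>f\<close>: with \<open>D\<close> in the family,
  inverse, product and invariant neighbourhoods behave well in the weak topology as far as
  \<open>f\<close> can test.\<close>

definition controls :: "'a set set \<Rightarrow> ('a \<Rightarrow> real) \<Rightarrow> ('a \<Rightarrow> real) set \<Rightarrow> bool" where
  "controls \<B> f D \<longleftrightarrow> (\<lambda>x. f (inv x)) \<in> D \<and>
     continuous_map (prod_topology (weak_topology (carrier G) D) (weak_topology (carrier G) D))
       euclideanreal (\<lambda>(x, y). f (x \<otimes> y)) \<and>
     (\<forall>n. \<exists>B\<in>\<B>. \<exists>g\<in>D. squeezes f n B g)"

end

lemma homeomorphic_Lindelof_space:
  assumes "X homeomorphic_space Y" "Lindelof_space Y"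
  shows "Lindelof_space X"
proof -
  obtain h where "homeomorphic_map Y X h"
    using assms(1) homeomorphic_space homeomorphic_space_sym by blast
  then show ?thesis
    using assms(2) Lindelof_space_quotient_map_image homeomorphic_map_def by blast
qed

context topological_gyrogroup
begin

lemma Lindelof_imp_completely_regular_space:
  "Lindelof_space T \<Longrightarrow> completely_regular_space T"
  using regular_Lindelof_imp_normal_space [OF regular_space] Hausdorff
  by (blast intro: normal_imp_completely_regular_space)

text \<open>\<open>D\<close> collects the factorization of \<open>f (x \<otimes> y)\<close> through
  countably many functions, the single function \<open>f (inv x)\<close>, and one squeezing function
  for each \<open>n\<close>.\<close>

lemma countable_control:
  assumes "Lindelof_space (prod_topology T T)" and cr: "completely_regular_space T"
    and base: "is_nbhd_base T \<one> \<B>" and f: "continuous_map T euclideanreal f"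
  shows "\<exists>D. countable D \<and> D \<subseteq> {g. continuous_map T euclideanreal g} \<and> controls \<B> f D"
proof -
  have "continuous_map (prod_topology T T) euclideanreal (\<lambda>(x, y). f (x \<otimes> y))"
    using continuous_map_compose [OF continuous_mult f] by (simp add: o_def case_prod_unfold)
  then obtain E where E: "countable E" "\<And>g. g \<in> E \<Longrightarrow> continuous_map T euclideanreal g"
    "continuous_map (prod_topology (weak_topology (carrier G) E) (weak_topology (carrier G) E))
      euclideanreal (\<lambda>(x, y). f (x \<otimes> y))"
    using Lindelof_prod_real_factor [OF assms(1) cr] unfolding topspace by blast
  have "\<exists>B\<in>\<B>. \<exists>g. continuous_map T euclideanreal g \<and> squeezes f n B g" for n
  proof -
    have "openin T {x \<in> topspace T. f x \<in> ball (f \<one>) (1 / real (Suc n))}"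
      by (rule openin_continuous_map_preimage [OF f]) auto
    moreover have "\<one> \<in> {x \<in> topspace T. f x \<in> ball (f \<one>) (1 / real (Suc n))}"
      by (simp add: topspace)
    ultimately obtain B where B: "B \<in> \<B>"
        "B \<subseteq> {x \<in> topspace T. f x \<in> ball (f \<one>) (1 / real (Suc n))}"
      using base unfolding is_nbhd_base_def by meson
    obtain W where W: "openin T W" "\<one> \<in> W" "W \<subseteq> B"
      using base B(1) unfolding is_nbhd_base_def by meson
    \<comment> \<open>\<open>g\<close> is 1 off \<open>W\<close>, so \<open>{g < 1}\<close> lies in
      \<open>W\<close> and hence in \<open>B\<close>.\<close>
    obtain g where g: "continuous_map T euclideanreal g" "g \<one> = 0" "g ` (topspace T - W) \<subseteq> {1}"
      using cr W unfolding completely_regular_space_alt' by meson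
    have "x \<in> W" if "x \<in> carrier G" "g x < 1" for x
      using g(3) that topspace by (metis Diff_iff image_subset_iff less_irrefl singletonD)
    then have "{x \<in> carrier G. g x < 1} \<subseteq> B" using W(3) by blast
    moreover have "B \<subseteq> {x. \<bar>f x - f \<one>\<bar> < 1 / real (Suc n)}"
      using B(2) by (auto simp: dist_real_def abs_minus_commute)
    ultimately show ?thesis using B(1) g(1,2)
      by (intro bexI [of _ B] exI [of _ g]) (simp_all add: squeezes_def)
  qed
  then obtain b g where bg: "\<And>n. b n \<in> \<B>" "\<And>n. continuous_map T euclideanreal (g n)"
      "\<And>n. squeezes f n (b n) (g n)"
    by metis
  define D where "D = insert (\<lambda>x. f (inv x)) (E \<union> range g)"
  have "continuous_map (prod_topology (weak_topology (carrier G) D) (weak_topology (carrier G) D))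
      euclideanreal (\<lambda>(x, y). f (x \<otimes> y))"
    by (rule continuous_map_prod_weak_topology_mono [OF E(3)]) (auto simp: D_def)
  moreover have "continuous_map T euclideanreal (\<lambda>x. f (inv x))"
    using continuous_map_compose [OF continuous_inverse f] by (simp add: o_def)
  moreover have "\<exists>B\<in>\<B>. \<exists>g\<in>D. squeezes f n B g" for n
    using bg(1,3) [of n] unfolding D_def by blast
  ultimately have "controls \<B> f D" "D \<subseteq> {g. continuous_map T euclideanreal g}"
    using E(2) bg(2) by (auto simp: controls_def D_def)
  moreover have "countable D"
    using E(1) by (simp add: D_def)
  ultimately show ?thesis by blast
qed

text \<open>Injectivity of gyrations lets the image commute with intersections. The factor
  \<open>carrier G\<close> takes care of the empty family, whose intersection is the whole
  type.\<close>

lemma gyr_image_Inter: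
  assumes "\<And>B. B \<in> \<C> \<Longrightarrow> B \<subseteq> carrier G" "\<And>B. B \<in> \<C> \<Longrightarrow> gyr G x y ` B = B"
    and xy: "x \<in> carrier G" "y \<in> carrier G"
  shows "gyr G x y ` (carrier G \<inter> \<Inter>\<C>) = carrier G \<inter> \<Inter>\<C>"
proof
  show "gyr G x y ` (carrier G \<inter> \<Inter>\<C>) \<subseteq> carrier G \<inter> \<Inter>\<C>"
    using assms gyr_closed by blast
  show "carrier G \<inter> \<Inter>\<C> \<subseteq> gyr G x y ` (carrier G \<inter> \<Inter>\<C>)"
  proof
    fix z assume z: "z \<in> carrier G \<inter> \<Inter>\<C>"
    then obtain u where u: "u \<in> carrier G" "z = gyr G x y u"
      using gyr_bij [OF xy] unfolding bij_betw_def by blast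
    have "u \<in> B" if B: "B \<in> \<C>" for B
    proof -
      obtain u' where u': "u' \<in> B" "z = gyr G x y u'"
        using z B assms(2) [OF B] by blast
      then have "u' = u"
        using gyr_bij [OF xy] u assms(1) [OF B] by (auto simp: bij_betw_def inj_on_def)
      with u' show ?thesis by simp
    qed
    with u show "z \<in> gyr G x y ` (carrier G \<inter> \<Inter>\<C>)" by blast
  qed
qed

text \<open>The core of the argument, with membership in the class replaced by the Lindelof
  properties it provides.\<close>

lemma metrizable_quotient:
  assumes Lin2: "Lindelof_space (prod_topology T T)" and "Lindelof_space T"
    and inv_base: "gyr_invariant_base G T \<B>"
    and U: "openin T U" "\<one> \<in> U"
  shows "\<exists>(H :: 'a set gyro) S \<pi> V.
    strongly_topological_gyrogroup H S \<and> metrizable_space S \<and>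
    \<pi> \<in> hom G H \<and> \<pi> ` carrier G = carrier H \<and> continuous_map T S \<pi> \<and>
    openin S V \<and> \<one>\<^bsub>H\<^esub> \<in> V \<and> {x \<in> carrier G. \<pi> x \<in> V} \<subseteq> U"
proof -
  have cr: "completely_regular_space T"
    by (rule Lindelof_imp_completely_regular_space) fact
  have base: "is_nbhd_base T \<one> \<B>"
    using inv_base by (simp add: gyr_invariant_base_def)
  have \<B>_mem: "B \<subseteq> carrier G" "\<lbrakk>x \<in> carrier G; y \<in> carrier G\<rbrakk> \<Longrightarrow> gyr G x y ` B = B"
    if "B \<in> \<B>" for B x y
    using that inv_base topspace by (simp_all add: gyr_invariant_base_def is_nbhd_base_def)
  \<comment> \<open>\<open>u\<close> is the seed of the closure: it puts the neighbourhood
    \<open>{u < 1}\<close> of the identity, which lies in \<open>U\<close>, into the weak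
    topology.\<close>
  obtain u where u: "continuous_map T euclideanreal u" "u \<one> = 0" "u ` (topspace T - U) \<subseteq> {1}"
    using cr U unfolding completely_regular_space_alt' by meson
  let ?C = "{g. continuous_map T euclideanreal g}"
  have "\<exists>D. countable D \<and> D \<subseteq> ?C \<and> controls \<B> f D" if "f \<in> ?C" for f
    using countable_control [OF Lin2 cr base, of f] that by simp
  moreover have "u \<in> ?C" using u(1) by simp
  ultimately obtain F where F: "countable F" "F \<subseteq> ?C" "u \<in> F" and
    step: "\<And>f. f \<in> F \<Longrightarrow> \<exists>D\<subseteq>F. controls \<B> f D"
    using countable_closure_operation [of u ?C "controls \<B>"] by blast
  define w where "w = weak_topology (carrier G) F"
  have top: "topspace w = carrier G" by (simp add: w_def)
  have mult: "continuous_map (prod_topology w w) w (\<lambda>(x, y). x \<otimes> y)"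
    unfolding w_def continuous_map_weak_topology
  proof (intro conjI ballI)
    fix f assume "f \<in> F"
    then obtain D where D: "D \<subseteq> F" "controls \<B> f D" using step by blast
    have "continuous_map (prod_topology (weak_topology (carrier G) F) (weak_topology (carrier G) F))
        euclideanreal (\<lambda>(x, y). f (x \<otimes> y))"
      by (rule continuous_map_prod_weak_topology_mono [OF _ D(1)]) (use D(2) controls_def in blast)
    then show "continuous_map (prod_topology (weak_topology (carrier G) F) (weak_topology (carrier G) F))
        euclideanreal (\<lambda>p. f (case p of (x, y) \<Rightarrow> x \<otimes> y))"
      by (simp add: o_def case_prod_unfold)
  qed (auto simp: closed)
  have inv: "continuous_map w w (m_inv G)"
    unfolding w_def continuous_map_weak_topology
  proof (intro conjI ballI)
    fix f assume "f \<in> F"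
    then obtain D where "D \<subseteq> F" "controls \<B> f D" using step by blast
    then have "(\<lambda>x. f (inv x)) \<in> F" by (auto simp: controls_def)
    then show "continuous_map (weak_topology (carrier G) F) euclideanreal (\<lambda>x. f (inv x))"
      by (rule continuous_map_weak_topology_mem)
  qed auto
  \<comment> \<open>A member of \<B> need not be a neighbourhood for the coarser topology
    \<open>w\<close>, so the base consists of all invariant sets that are.\<close>
  define \<A> where "\<A> = {B. B \<subseteq> carrier G \<and> (\<exists>W. openin w W \<and> \<one> \<in> W \<and> W \<subseteq> B) \<and>
    (\<forall>x\<in>carrier G. \<forall>y\<in>carrier G. gyr G x y ` B = B)}"
  have "\<exists>B\<in>\<A>. B \<subseteq> W" if W: "openin w W" "\<one> \<in> W" for W
  proof -
    obtain K and n :: nat where K: "finite K" "K \<subseteq> F"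
      "{y \<in> carrier G. \<forall>f\<in>K. \<bar>f y - f \<one>\<bar> < 1 / real (Suc n)} \<subseteq> W"
      by (rule weak_topology_nbhd [OF W(1) [unfolded w_def] W(2)])
    have "\<exists>B\<in>\<B>. \<exists>g\<in>F. squeezes f n B g" if "f \<in> K" for f
    proof -
      have "f \<in> F" using that K(2) by blast
      then obtain D where D: "D \<subseteq> F" "controls \<B> f D" using step by blast
      then have "\<exists>B\<in>\<B>. \<exists>g\<in>D. squeezes f n B g" by (simp add: controls_def)
      with D(1) show ?thesis by blast
    qed
    then obtain b g where bg: "\<And>f. f \<in> K \<Longrightarrow> b f \<in> \<B>" "\<And>f. f \<in> K \<Longrightarrow> g f \<in> F"
        "\<And>f. f \<in> K \<Longrightarrow> squeezes f n (b f) (g f)"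
      by metis
    \<comment> \<open>Each \<open>b f\<close> is invariant, contains \<open>{g f < 1}\<close> and
      lies within the required radius for \<open>f\<close>; the finite intersection inherits all
      three properties.\<close>
    define B where "B = carrier G \<inter> \<Inter>(b ` K)"
    have "B \<in> \<A>"
      unfolding \<A>_def mem_Collect_eq
    proof (intro conjI ballI)
      show "B \<subseteq> carrier G" by (simp add: B_def)
      show "\<exists>W. openin w W \<and> \<one> \<in> W \<and> W \<subseteq> B"
      proof (intro exI conjI)
        \<comment> \<open>Intersecting with the whole space covers the case of empty
          \<open>K\<close>.\<close>
        show "openin w ((\<Inter>f\<in>K. {x \<in> carrier G. g f x < 1}) \<inter> topspace w)"
          unfolding w_def
          by (rule openin_INT [OF K(1)]) (use bg(2) openin_weak_topology_less in blast)
      qed (use bg(3) in \<open>auto simp: top B_def squeezes_def\<close>)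
      fix x y assume xy: "x \<in> carrier G" "y \<in> carrier G"
      show "gyr G x y ` B = B"
        unfolding B_def by (rule gyr_image_Inter [OF _ _ xy]) (use bg(1) \<B>_mem xy in blast)+
    qed
    moreover have "B \<subseteq> W"
      using K(3) bg(3) unfolding B_def squeezes_def by blast
    ultimately show ?thesis by blast
  qed
  then have "gyr_invariant_base G w \<A>"
    unfolding gyr_invariant_base_def is_nbhd_base_def by (auto simp: \<A>_def top)
  from weak_topology_quotient [OF F(1), folded w_def, OF mult inv this]
  obtain H :: "'a set gyro" and S and p where H: "strongly_topological_gyrogroup H S"
    "metrizable_space S" "p \<in> hom G H" "p ` carrier G = carrier H" "continuous_map w S p"
    "p \<one> = \<one>\<^bsub>H\<^esub>" "\<And>W. openin w W \<Longrightarrow> \<exists>V. openin S V \<and> W = {x \<in> carrier G. p x \<in> V}"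
    by blast
  have "continuous_map T w id"
    unfolding w_def continuous_map_weak_topology using F(2) topspace by auto
  from continuous_map_compose [OF this H(5)] have "continuous_map T S p"
    by simp
  \<comment> \<open>This set is open for \<open>w\<close>, hence the full preimage of an open
    \<open>V\<close>; it contains the identity because \<open>u\<close> vanishes there.\<close>
  moreover have "openin w {x \<in> carrier G. u x < 1}"
    unfolding w_def by (rule openin_weak_topology_less [OF F(3)])
  then obtain V where V: "openin S V" "{x \<in> carrier G. u x < 1} = {x \<in> carrier G. p x \<in> V}"
    using H(7) by blast
  have "x \<in> U" if "x \<in> carrier G" "u x < 1" for x
    using u(3) that topspace by (metis Diff_iff image_subset_iff less_irrefl singletonD)
  then have "{x \<in> carrier G. u x < 1} \<subseteq> U" by blast
  moreover have "\<one>\<^bsub>H\<^esub> \<in> V"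
    using V(2) u(2) H(6) one_closed by (metis (mono_tags, lifting) mem_Collect_eq zero_less_one)
  ultimately show ?thesis
    using H V by (intro exI [of _ H] exI [of _ S] exI [of _ p] exI [of _ V]) auto
qed

end

theorem theorem3p4:
  fixes G :: "'a gyro" and T :: "'a topology" and \<B> :: "'a set set"
    and \<L> :: "'u topology set" and U :: "'a set"
  assumes "productive_Lindelof_class \<L>"
    and "in_class T \<L>"
    and "strongly_topological_gyrogroup G T"
    and "symmetric_base G T \<B>"
    and "openin T U" and "\<one>\<^bsub>G\<^esub> \<in> U"
  shows "\<exists>(H :: 'a set gyro) (S :: 'a set topology) (\<pi> :: 'a \<Rightarrow> 'a set) V.
    strongly_topological_gyrogroup H S \<and> metrizable_space S \<and>
    \<pi> \<in> hom G H \<and> \<pi> ` carrier G = carrier H \<and> continuous_map T S \<pi> \<and>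
    openin S V \<and> \<one>\<^bsub>H\<^esub> \<in> V \<and> {x \<in> carrier G. \<pi> x \<in> V} \<subseteq> U"
proof -
  interpret strongly_topological_gyrogroup G T by fact
  obtain Y where Y: "Y \<in> \<L>" "T homeomorphic_space Y"
    using assms(2) by (auto simp: in_class_def)
  then have "in_class (prod_topology Y Y) \<L>"
    using assms(1) by (simp add: productive_Lindelof_class_def)
  then obtain Z where Z: "Z \<in> \<L>" "prod_topology Y Y homeomorphic_space Z"
    unfolding in_class_def by blast
  \<comment> \<open>Membership is only up to homeomorphism, so the square of \<open>T\<close> is
    compared with a member of the class through the square of \<open>Y\<close>.\<close>
  have "prod_topology T T homeomorphic_space Z"
    using homeomorphic_space_prod_topology [OF Y(2) Y(2)] Z(2) homeomorphic_space_trans by blast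
  then have Lin2: "Lindelof_space (prod_topology T T)"
    using homeomorphic_Lindelof_space Z(1) assms(1) by (auto simp: productive_Lindelof_class_def)
  have "Lindelof_space T"
    using homeomorphic_Lindelof_space Y assms(1) by (auto simp: productive_Lindelof_class_def)
  moreover have "gyr_invariant_base G T \<B>"
    using assms(4) by (simp add: symmetric_base_def)
  ultimately show ?thesis
    using metrizable_quotient [OF Lin2] assms(5,6) by blast
qed

end
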